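(* Let $n\geq1$ be an integer, $\gamma\in(0,n)$, and let $q_1,q_2$ be real numbers with $\min\{q_1,q_2\}>0$. Consider the system $$\begin{cases}u(x)=\displaystyle\int_{\mathbb{R}^n}\frac{v^{q_2}(y)}{|x-y|^{n-\gamma}|y|^{\gamma}}\,dy,\\[2mm] v(x)=\displaystyle\int_{\mathbb{R}^n}\frac{u^{q_1}(y)}{|x-y|^{n-\gamma}|x|^{\gamma}}\,dy.\end{cases}$$ (i) If at least one of the three conditions $0<q_1q_2<1$, $0<q_1\leq\frac{\gamma}{n-\gamma}$, $q_2\geq\frac{n-\gamma}{\gamma}$ holds, then the system has no positive super solution $(u,v)$ with $u,v\in L^\infty_{loc}(\mathbb{R}^n\setminus\{0\})$, for any positive constants $c_1$ and $c_2$. (ii) If $q_1q_2=1$ and $q_1>\frac{\gamma}{n-\gamma}$ (or $0<q_2<\frac{n-\gamma}{\gamma}$), then the system has positive super solutions, and also positive lower solutions, $(u,v)$ with $u$ and $v$ radially symmetric and decreasing (in $|x|$) and $u,v\in L^\infty_{loc}(\mathbb{R}^n\setminus\{0\})$.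
   Context: A pair of functions $(u,v)$, positive in $\mathbb{R}^n\setminus\{0\}$, is called a positive super solution (respectively lower solution) of the system if there are positive constants $c_1,c_2$ such that for $x\in\mathbb{R}^n\setminus\{0\}$ $$u(x)\geq(\leq)\ c_1\int_{\mathbb{R}^n}\frac{v^{q_2}(y)}{|x-y|^{n-\gamma}|y|^{\gamma}}\,dy,\qquad v(x)\geq(\leq)\ c_2\int_{\mathbb{R}^n}\frac{u^{q_1}(y)}{|x-y|^{n-\gamma}|x|^{\gamma}}\,dy,$$ with $\geq$ in both inequalities for super solutions and $\leq$ in both for lower solutions. $L^\infty_{loc}(\mathbb{R}^n\setminus\{0\})$ is the set of measurable functions bounded on each compact subset of $\mathbb{R}^n\setminus\{0\}$. *)

theory Defs
  imports "HOL-Analysis.Analysis"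
begin

text \<open>
  The right-hand sides of the two equations of the system, with values in \<open>[0, \<infinity>]\<close>.
  Since \<open>0 powr a = 0\<close> and \<open>t / 0 = 0\<close>, the integrands take conventional values at
  \<open>y = x\<close> and \<open>y = 0\<close>; these points form a null set.  In particular the values of \<open>u\<close>
  and \<open>v\<close> at the origin play no role.
\<close>

definition rhs1 :: "real \<Rightarrow> real \<Rightarrow> (real ^ 'n \<Rightarrow> real) \<Rightarrow> real ^ 'n \<Rightarrow> ennreal" where
  "rhs1 \<gamma> q\<^sub>2 v x =
     (\<integral>\<^sup>+ y. ennreal (v y powr q\<^sub>2 / (norm (x - y) powr (real CARD('n) - \<gamma>) * norm y powr \<gamma>)) \<partial>lebesgue)"

definition rhs2 :: "real \<Rightarrow> real \<Rightarrow> (real ^ 'n \<Rightarrow> real) \<Rightarrow> real ^ 'n \<Rightarrow> ennreal" where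
  "rhs2 \<gamma> q\<^sub>1 u x =
     (\<integral>\<^sup>+ y. ennreal (u y powr q\<^sub>1 / (norm (x - y) powr (real CARD('n) - \<gamma>) * norm x powr \<gamma>)) \<partial>lebesgue)"

definition pos_super_solution ::
  "real \<Rightarrow> real \<Rightarrow> real \<Rightarrow> (real ^ 'n \<Rightarrow> real) \<Rightarrow> (real ^ 'n \<Rightarrow> real) \<Rightarrow> bool" where
  "pos_super_solution \<gamma> q\<^sub>1 q\<^sub>2 u v \<longleftrightarrow>
     (\<forall>x. x \<noteq> 0 \<longrightarrow> 0 < u x \<and> 0 < v x) \<and>
     (\<exists>c\<^sub>1>0. \<exists>c\<^sub>2>0. \<forall>x. x \<noteq> 0 \<longrightarrow>
        ennreal (u x) \<ge> ennreal c\<^sub>1 * rhs1 \<gamma> q\<^sub>2 v x \<and>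
        ennreal (v x) \<ge> ennreal c\<^sub>2 * rhs2 \<gamma> q\<^sub>1 u x)"

text \<open>
  For super solutions the integrals are finite automatically.  For lower solutions their
  convergence is required explicitly, as otherwise divergent integrals would satisfy the
  inequalities trivially.
\<close>

definition pos_lower_solution ::
  "real \<Rightarrow> real \<Rightarrow> real \<Rightarrow> (real ^ 'n \<Rightarrow> real) \<Rightarrow> (real ^ 'n \<Rightarrow> real) \<Rightarrow> bool" where
  "pos_lower_solution \<gamma> q\<^sub>1 q\<^sub>2 u v \<longleftrightarrow>
     (\<forall>x. x \<noteq> 0 \<longrightarrow> 0 < u x \<and> 0 < v x) \<and>
     (\<forall>x. x \<noteq> 0 \<longrightarrow> rhs1 \<gamma> q\<^sub>2 v x < \<infinity> \<and> rhs2 \<gamma> q\<^sub>1 u x < \<infinity>) \<and>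
     (\<exists>c\<^sub>1>0. \<exists>c\<^sub>2>0. \<forall>x. x \<noteq> 0 \<longrightarrow>
        ennreal (u x) \<le> ennreal c\<^sub>1 * rhs1 \<gamma> q\<^sub>2 v x \<and>
        ennreal (v x) \<le> ennreal c\<^sub>2 * rhs2 \<gamma> q\<^sub>1 u x)"

definition Linfty_loc :: "(real ^ 'n \<Rightarrow> real) set" where
  "Linfty_loc =
     {f. f \<in> borel_measurable (lebesgue_on (UNIV - {0})) \<and>
         (\<forall>K. compact K \<and> K \<subseteq> UNIV - {0} \<longrightarrow> bounded (f ` K))}"

definition radially_decreasing :: "(real ^ 'n \<Rightarrow> real) \<Rightarrow> bool" where
  "radially_decreasing f \<longleftrightarrow>
     (\<exists>g. strict_antimono_on {0<..} g \<and> (\<forall>x. x \<noteq> 0 \<longrightarrow> f x = g (norm x)))"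

end

theory Submission
  imports Defs
begin

text \<open>
  Nonexistence: a super solution satisfies \<open>u(x) \<ge> k|x|\<^bsup>-(n - \<gamma>)\<^esup>\<close> for \<open>|x| \<ge> 1\<close> and
  \<open>v(x) \<ge> k|x|\<^bsup>-\<gamma>\<^esup>\<close> for \<open>|x| \<le> 1\<close>.  If \<open>q\<^sub>2 \<ge> (n - \<gamma>)/\<gamma>\<close>, the second bound makes the
  integral for \<open>u\<close> diverge at the origin.  If \<open>u(x) \<ge> k|x|\<^bsup>-a\<^esup>\<close> for \<open>|x| \<ge> 1\<close> with \<open>a q\<^sub>1 \<le> \<gamma>\<close>, the
  integral for \<open>v\<close> diverges at infinity; for \<open>q\<^sub>1 \<le> \<gamma>/(n - \<gamma>)\<close> the exponent \<open>a = n - \<gamma>\<close> is already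
  small enough.  If \<open>q\<^sub>1 q\<^sub>2 < 1\<close>, integrating over the shell \<open>|x| \<le> |y| < 2|x|\<close> in both inequalities
  improves the exponent \<open>a\<close> to \<open>a q\<^sub>1 q\<^sub>2\<close>, and finitely many steps make it small enough.

  Existence: for \<open>q\<^sub>1 q\<^sub>2 = 1\<close> and \<open>\<gamma>/q\<^sub>1 < a < min (n - \<gamma>) (n/q\<^sub>1)\<close>, the integrals of
  \<open>u = |x|\<^bsup>-a\<^esup>\<close> and \<open>v = |x|\<^bsup>-a q\<^sub>1\<^esup>\<close> converge and are comparable to \<open>v\<close> and \<open>u\<close>, so the same pair is
  both a super and a lower solution.
\<close>

subsection \<open>Powers of the norm on dyadic shells\<close>

text \<open>Half open, so that the shells of radii R 2^k tile the punctured space without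
  overlap.\<close>

definition shell :: "real \<Rightarrow> 'a::euclidean_space set" where
  "shell r = {y. r \<le> norm y \<and> norm y < 2 * r}"

text \<open>The volume of \<open>shell 1\<close>, a difference of two balls; the
  \<open>itself\<close> argument supplies the dimension.\<close>

definition shell_vol :: "'a::euclidean_space itself \<Rightarrow> real" where
  "shell_vol _ = unit_ball_vol (real DIM('a)) * (2 ^ DIM('a) - 1)"

lemma shell_vol_pos: "shell_vol TYPE('a::euclidean_space) > 0"
  by (simp add: shell_vol_def)

lemma shell_borel [measurable]: "shell r \<in> sets borel"
  unfolding shell_def by measurable

lemma emeasure_shell:
  assumes "r > 0"
  shows "emeasure lborel (shell r :: 'a::euclidean_space set)
    = ennreal (shell_vol TYPE('a) * r powr DIM('a))"
proof -
  have eq: "shell r = ball 0 (2 * r) - ball (0::'a) r"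
    by (auto simp: shell_def)
  have "emeasure lborel (shell r :: 'a set) = emeasure lborel (ball (0::'a) (2 * r)) - emeasure lborel (ball (0::'a) r)"
    unfolding eq using assms by (intro emeasure_Diff) (auto simp: emeasure_ball)
  also have "\<dots> = ennreal (unit_ball_vol (real DIM('a)) * (2 * r) ^ DIM('a) - unit_ball_vol (real DIM('a)) * r ^ DIM('a))"
    using assms by (simp add: emeasure_ball ennreal_minus)
  also have "unit_ball_vol (real DIM('a)) * (2 * r) ^ DIM('a) - unit_ball_vol (real DIM('a)) * r ^ DIM('a)
     = shell_vol TYPE('a) * r powr DIM('a)"
    using assms by (simp add: shell_vol_def powr_realpow power_mult_distrib algebra_simps)
  finally show ?thesis .
qed

lemma shell_integral_upper:
  assumes "r > 0" "s \<ge> 0"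
  shows "(\<integral>\<^sup>+y\<in>shell r. ennreal (norm (y::'a::euclidean_space) powr - s) \<partial>lborel)
    \<le> ennreal (shell_vol TYPE('a) * r powr (real DIM('a) - s))"
proof -
  have "(\<integral>\<^sup>+y\<in>shell r. ennreal (norm (y::'a) powr - s) \<partial>lborel)
     \<le> (\<integral>\<^sup>+(y::'a)\<in>shell r. ennreal (r powr - s) \<partial>lborel)"
    using assms
    by (intro nn_integral_mono) (auto simp: shell_def indicator_def intro!: ennreal_leI powr_mono2')
  also have "\<dots> = ennreal (r powr - s) * ennreal (shell_vol TYPE('a) * r powr DIM('a))"
    using assms by (simp add: nn_integral_cmult_indicator emeasure_shell)
  also have "\<dots> = ennreal (shell_vol TYPE('a) * r powr (real DIM('a) - s))"
    using assms by (simp add: ennreal_mult'[symmetric] powr_diff powr_minus field_simps)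
  finally show ?thesis .
qed

text \<open>The bound on g is assumed almost everywhere because the integrands with kernel |x -
  y|^(-\<beta>) take the value 0 at y = x, where division by 0 yields 0.\<close>

lemma shell_integral_lower:
  fixes g :: "'a::euclidean_space \<Rightarrow> ennreal"
  assumes "r > 0" "m \<ge> 0" and "AE y in lborel. y \<in> shell r \<longrightarrow> ennreal m \<le> g y"
  shows "ennreal (shell_vol TYPE('a) * m * r powr DIM('a)) \<le> (\<integral>\<^sup>+y\<in>shell r. g y \<partial>lborel)"
proof -
  have "ennreal (shell_vol TYPE('a) * m * r powr DIM('a)) = ennreal m * ennreal (shell_vol TYPE('a) * r powr DIM('a))"
    using assms by (simp add: ennreal_mult'[symmetric] field_simps)
  also have "\<dots> = (\<integral>\<^sup>+(y::'a)\<in>shell r. ennreal m \<partial>lborel)"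
    using assms by (simp add: nn_integral_cmult_indicator emeasure_shell)
  also have "\<dots> \<le> (\<integral>\<^sup>+y\<in>shell r. g y \<partial>lborel)"
    using assms(3) by (intro nn_integral_mono_AE) (auto simp: indicator_def)
  finally show ?thesis .
qed

text \<open>A point y determines its shell: the floor of log_2(|y|/R) equals \<sigma> k. The sign
  \<sigma> = 1 lists shells going out to infinity, \<sigma> = -1 shells shrinking to the
  origin.\<close>

lemma disjoint_shells:
  assumes "R > 0" "\<sigma> \<in> {1, -1}"
  shows "disjoint_family (\<lambda>k. shell (R * 2 powr (\<sigma> * real k)) :: 'a::euclidean_space set)"
proof -
  obtain j :: int where j: "\<sigma> = real_of_int j" "j \<noteq> 0"
    using assms(2) by (metis insertE of_int_1 of_int_minus singletonD zero_neq_neg_one zero_neq_one)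
  have "\<lfloor>log 2 (norm y / R)\<rfloor> = j * int k"
    if "y \<in> shell (R * 2 powr (\<sigma> * real k))" for y :: 'a and k
  proof -
    have "norm y / R > 0"
      using that assms(1) unfolding shell_def
      by (auto intro!: divide_pos_pos less_le_trans[of 0 "R * 2 powr (\<sigma> * real k)" "norm y"] simp del: zero_less_norm_iff)
    then show ?thesis
      using that assms(1)
      by (subst floor_log_eq_powr_iff) (auto simp: shell_def field_simps powr_add j(1))
  qed
  then show ?thesis
    unfolding disjoint_family_on_def
    by (metis disjoint_iff mult_left_cancel of_nat_eq_iff j(2))
qed

lemma shells_outside:
  assumes "R > 0" "R \<le> norm y"
  shows "y \<in> (\<Union>k. shell (R * 2 powr (1 * real k)))"
proof -
  define k where "k = \<lfloor>log 2 (norm y / R)\<rfloor>"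
  have ge: "norm y / R \<ge> 1"
    using assms by simp
  then have pos: "norm y / R > 0"
    by linarith
  then have "log 2 (norm y / R) \<ge> 0"
    using ge by simp
  then have k: "k \<ge> 0"
    by (simp add: k_def)
  have "2 powr k \<le> norm y / R \<and> norm y / R < 2 powr (k + 1)"
    using pos floor_log_eq_powr_iff[of "norm y / R" 2 k] by (auto simp: k_def)
  then have "y \<in> shell (R * 2 powr (1 * real (nat k)))"
    using k assms by (auto simp: shell_def field_simps powr_add)
  then show ?thesis by blast
qed

text \<open>The bound is 2 R because the outermost shell, k = 0, is R \<le> |y| < 2 R.\<close>

lemma shells_inside:
  assumes "R > 0" "0 < norm y" "norm y < 2 * R"
  shows "y \<in> (\<Union>k. shell (R * 2 powr (- 1 * real k)))"
proof -
  define k where "k = \<lfloor>log 2 (norm y / R)\<rfloor>"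
  have pos: "0 < norm y / R" and "norm y / R < 2"
    using assms by (auto simp del: zero_less_norm_iff simp: pos_divide_less_eq mult.commute)
  then have "log 2 (norm y / R) < 1"
    by (subst log_less_iff) auto
  then have k: "k \<le> 0"
    by (simp add: k_def floor_le_iff)
  have "2 powr k \<le> norm y / R \<and> norm y / R < 2 powr (k + 1)"
    using pos floor_log_eq_powr_iff[of "norm y / R" 2 k] by (auto simp: k_def)
  then have "y \<in> shell (R * 2 powr (- 1 * real (nat (- k))))"
    using k assms by (auto simp: shell_def field_simps powr_add)
  then show ?thesis by blast
qed

lemma shells_integral:
  assumes "R > 0" "\<sigma> \<in> {1, -1}"
  shows "(\<integral>\<^sup>+y\<in>(\<Union>k. shell (R * 2 powr (\<sigma> * real k))). ennreal (norm (y::'a::euclidean_space) powr - s) \<partial>lborel)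
    = (\<Sum>k. \<integral>\<^sup>+y\<in>shell (R * 2 powr (\<sigma> * real k)). ennreal (norm (y::'a) powr - s) \<partial>lborel)"
  by (intro nn_integral_disjoint_family disjoint_shells assms) auto

text \<open>With n the dimension, the k-th shell contributes at most a constant times R^(n - s) q^k
  with q = 2^(\<sigma> (n - s)). The sign condition says q < 1: s < n for integrability at 0, s > n
  at infinity. The geometric sum does not depend on R, so C serves all radii.\<close>

lemma shells_integral_upper:
  assumes "s \<ge> 0" "\<sigma> \<in> {1, -1}" "\<sigma> * (real DIM('a::euclidean_space) - s) < 0"
  obtains C where "C > 0"
    "\<And>R. R > 0 \<Longrightarrow>
      (\<integral>\<^sup>+y\<in>(\<Union>k. shell (R * 2 powr (\<sigma> * real k))). ennreal (norm (y::'a) powr - s) \<partial>lborel)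
      \<le> ennreal (C * R powr (real DIM('a) - s))"
proof -
  define q where "q = 2 powr (\<sigma> * (real DIM('a) - s))"
  have q: "0 < q" "q < 1"
    using assms(3) by (auto simp: q_def powr_less_one)
  show thesis
  proof (rule that)
    show "shell_vol TYPE('a) * (1 / (1 - q)) > 0"
      using q by (simp add: shell_vol_pos)
    fix R :: real assume R: "R > 0"
    let ?K = "shell_vol TYPE('a) * R powr (real DIM('a) - s)"
    have "(\<integral>\<^sup>+y\<in>shell (R * 2 powr (\<sigma> * real k)). ennreal (norm (y::'a) powr - s) \<partial>lborel)
       \<le> ennreal (?K * q ^ k)" for k
    proof -
      have "(R * 2 powr (\<sigma> * real k)) powr (real DIM('a) - s) = R powr (real DIM('a) - s) * q ^ k"
        using R by (simp add: powr_mult powr_powr q_def mult_ac flip: powr_realpow)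
      then show ?thesis
        using shell_integral_upper[of "R * 2 powr (\<sigma> * real k)" s, where 'a='a] R assms
        by (simp add: mult_ac)
    qed
    then have "(\<Sum>k. \<integral>\<^sup>+y\<in>shell (R * 2 powr (\<sigma> * real k)). ennreal (norm (y::'a) powr - s) \<partial>lborel)
      \<le> (\<Sum>k. ennreal (?K * q ^ k))"
      by (intro suminf_le summableI)
    also have "\<dots> = ennreal (?K * (1 / (1 - q)))"
      using q geometric_sums[of q] shell_vol_pos[where 'a='a]
      by (intro suminf_ennreal_eq sums_mult) (auto intro!: mult_nonneg_nonneg)
    finally show "(\<integral>\<^sup>+y\<in>(\<Union>k. shell (R * 2 powr (\<sigma> * real k))). ennreal (norm (y::'a) powr - s) \<partial>lborel)
      \<le> ennreal (shell_vol TYPE('a) * (1 / (1 - q)) * R powr (real DIM('a) - s))"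
      using shells_integral[OF R assms(2), of s, where 'a='a] by (simp add: mult_ac)
  qed
qed

text \<open>At the critical exponent n the factors r^n and (2 r)^(-n) cancel up to 2^(-n), so every
  shell contributes at least the same positive amount, both towards 0 and towards infinity.\<close>

lemma shells_integral_infinite:
  assumes "R > 0" "\<sigma> \<in> {1, -1}"
  shows "(\<integral>\<^sup>+y\<in>(\<Union>k. shell (R * 2 powr (\<sigma> * real k))). ennreal (norm (y::'a::euclidean_space) powr - real DIM('a)) \<partial>lborel) = \<infinity>"
proof -
  let ?d = "shell_vol TYPE('a) * 2 powr - real DIM('a)"
  have "ennreal ?d \<le> (\<integral>\<^sup>+y\<in>shell r. ennreal (norm (y::'a) powr - real DIM('a)) \<partial>lborel)" if "r > 0" for r
  proof -
    have "ennreal (shell_vol TYPE('a) * (2 * r) powr - real DIM('a) * r powr DIM('a))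
       \<le> (\<integral>\<^sup>+y\<in>shell r. ennreal (norm (y::'a) powr - real DIM('a)) \<partial>lborel)"
      using that by (intro shell_integral_lower AE_I2) (auto simp: shell_def intro!: ennreal_leI powr_mono2')
    moreover have "shell_vol TYPE('a) * (2 * r) powr - real DIM('a) * r powr DIM('a) = ?d"
      using that by (simp add: powr_mult powr_minus field_simps)
    ultimately show ?thesis by simp
  qed
  then have "(\<Sum>k. ennreal ?d) \<le> (\<Sum>k. \<integral>\<^sup>+y\<in>shell (R * 2 powr (\<sigma> * real k)). ennreal (norm (y::'a) powr - real DIM('a)) \<partial>lborel)"
    using assms by (intro suminf_le summableI) auto
  moreover have "(\<Sum>k::nat. ennreal ?d) = \<infinity>"
  proof (rule ccontr)
    assume "(\<Sum>k::nat. ennreal ?d) \<noteq> \<infinity>"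
    then have "summable (\<lambda>k::nat. ?d)"
      using shell_vol_pos[where 'a='a] by (intro summable_suminf_not_top) auto
    then show False
      using shell_vol_pos[where 'a='a] by (simp add: summable_const_iff)
  qed
  ultimately show ?thesis
    using shells_integral[OF assms, of "real DIM('a)", where 'a='a] by (simp add: top_unique)
qed

lemma nn_integral_infinite_of_shells:
  fixes g :: "'a::euclidean_space \<Rightarrow> ennreal"
  assumes "c > 0" "R > 0" "\<sigma> \<in> {1, -1}"
    and "AE y in lborel. y \<in> (\<Union>k. shell (R * 2 powr (\<sigma> * real k))) \<longrightarrow>
      ennreal (c * norm y powr - real DIM('a)) \<le> g y"
  shows "(\<integral>\<^sup>+y. g y \<partial>lborel) = \<infinity>"
proof -
  let ?S = "\<Union>k. shell (R * 2 powr (\<sigma> * real k)) :: 'a set"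
  have "\<infinity> = ennreal c * (\<integral>\<^sup>+y\<in>?S. ennreal (norm y powr - real DIM('a)) \<partial>lborel)"
    using assms by (subst shells_integral_infinite) (auto simp: ennreal_mult_top)
  also have "\<dots> = (\<integral>\<^sup>+y. ennreal c * (ennreal (norm y powr - real DIM('a)) * indicator ?S y) \<partial>lborel)"
    by (rule nn_integral_cmult[symmetric]) measurable
  also have "\<dots> \<le> (\<integral>\<^sup>+y. g y \<partial>lborel)"
    using assms(1,4) by (intro nn_integral_mono_AE) (auto simp: indicator_def ennreal_mult')
  finally show ?thesis
    by (simp add: top_unique)
qed

subsection \<open>Riesz potentials\<close>

text \<open>On the shell |x| \<le> |y| < 2|x| one has |x - y| \<le> 3|x|, so the kernel is at least
  (3|x|)^(-\<beta>) for y different from x; the volume of the shell provides the factor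
  |x|^n.\<close>

lemma kernel_lower:
  fixes x :: "'a::euclidean_space"
  assumes "\<beta> \<ge> 0" "x \<noteq> 0" "m \<ge> 0" and f: "\<And>y. y \<in> shell (norm x) \<Longrightarrow> m \<le> f y"
  shows "ennreal (shell_vol TYPE('a) * 3 powr - \<beta> * m * norm x powr (real DIM('a) - \<beta>))
    \<le> (\<integral>\<^sup>+y. ennreal (f y / norm (x - y) powr \<beta>) \<partial>lborel)"
proof -
  have *: "m * (3 * norm x) powr - \<beta> \<le> f y / norm (x - y) powr \<beta>"
    if "y \<in> shell (norm x)" "y \<noteq> x" for y
  proof -
    have "norm (x - y) \<le> 3 * norm x"
      using that norm_triangle_ineq4[of x y] by (simp add: shell_def)
    then have "(3 * norm x) powr - \<beta> \<le> norm (x - y) powr - \<beta>"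
      using that assms by (intro powr_mono2') auto
    then have "m * (3 * norm x) powr - \<beta> \<le> f y * norm (x - y) powr - \<beta>"
      using f[OF that(1)] assms by (intro mult_mono) auto
    then show ?thesis
      by (simp add: powr_minus_divide)
  qed
  have "shell_vol TYPE('a) * 3 powr - \<beta> * m * norm x powr (real DIM('a) - \<beta>)
    = shell_vol TYPE('a) * (m * (3 * norm x) powr - \<beta>) * norm x powr DIM('a)"
    using assms by (simp add: powr_mult powr_diff powr_minus field_simps)
  also have "ennreal \<dots> \<le> (\<integral>\<^sup>+y\<in>shell (norm x). ennreal (f y / norm (x - y) powr \<beta>) \<partial>lborel)"
    using assms(2,3) AE_lborel_singleton[of x]
    by (intro shell_integral_lower) (auto elim!: eventually_mono intro!: ennreal_leI *)
  also have "\<dots> \<le> (\<integral>\<^sup>+y. ennreal (f y / norm (x - y) powr \<beta>) \<partial>lborel)"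
    by (intro nn_integral_mono) (auto simp: indicator_def)
  finally show ?thesis .
qed

text \<open>For |x| = 1 \<le> |y| one has |x - y| \<le> 2|y|, so the integrand dominates a multiple
  of |y|^(-n) at infinity.\<close>

lemma kernel_infinite_outside:
  fixes x :: "'a::euclidean_space"
  assumes "\<beta> \<ge> 0" "norm x = 1" "c > 0"
    and f: "\<And>y. norm y \<ge> 1 \<Longrightarrow> c * norm y powr (\<beta> - real DIM('a)) \<le> f y"
  shows "(\<integral>\<^sup>+y. ennreal (f y / norm (x - y) powr \<beta>) \<partial>lborel) = \<infinity>"
proof (rule nn_integral_infinite_of_shells[where R = 1 and \<sigma> = 1 and c = "c * 2 powr - \<beta>"])
  have "c * 2 powr - \<beta> * norm y powr - real DIM('a) \<le> f y / norm (x - y) powr \<beta>"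
    if "norm y \<ge> 1" "y \<noteq> x" for y
  proof -
    have "norm (x - y) \<le> 2 * norm y"
      using that assms norm_triangle_ineq4[of x y] by simp
    then have "(2 * norm y) powr - \<beta> \<le> norm (x - y) powr - \<beta>"
      using that assms by (intro powr_mono2') auto
    then have "c * norm y powr (\<beta> - real DIM('a)) * (2 * norm y) powr - \<beta> \<le> f y * norm (x - y) powr - \<beta>"
      using f[OF that(1)] assms by (intro mult_mono order_trans[OF _ f[OF that(1)]]) auto
    moreover have "c * norm y powr (\<beta> - real DIM('a)) * (2 * norm y) powr - \<beta> = c * 2 powr - \<beta> * norm y powr - real DIM('a)"
      using that by (auto simp: powr_mult powr_diff powr_minus field_simps)
    ultimately show ?thesis
      by (simp add: powr_minus_divide)
  qed
  moreover have "norm y \<ge> 1" if "y \<in> shell (1 * 2 powr (1 * real k))" for y :: 'a and k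
    using that ge_one_powr_ge_zero[of 2 "real k"] by (simp add: shell_def)
  ultimately show "AE y in lborel. y \<in> (\<Union>k. shell (1 * 2 powr (1 * real k))) \<longrightarrow>
      ennreal (c * 2 powr - \<beta> * norm y powr - real DIM('a)) \<le> ennreal (f y / norm (x - y) powr \<beta>)"
    using AE_lborel_singleton[of x] by (auto elim!: eventually_mono intro!: ennreal_leI)
qed (use assms in auto)

text \<open>For |x| = 1 and |y| \<le> 1 the kernel is at least 2^(-\<beta>), so the singularity of f
  at the origin alone makes the integral diverge.\<close>

lemma kernel_infinite_inside:
  fixes x :: "'a::euclidean_space"
  assumes "\<beta> \<ge> 0" "norm x = 1" "c > 0"
    and f: "\<And>y. 0 < norm y \<Longrightarrow> norm y \<le> 1 \<Longrightarrow> c * norm y powr - real DIM('a) \<le> f y"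
  shows "(\<integral>\<^sup>+y. ennreal (f y / norm (x - y) powr \<beta>) \<partial>lborel) = \<infinity>"
\<comment> \<open>With R = 1/2 the outermost shell ends at radius 1, so all shells stay where f is
  bounded below.\<close>
proof (rule nn_integral_infinite_of_shells[where R = "1/2" and \<sigma> = "-1" and c = "c * 2 powr - \<beta>"])
  have "c * 2 powr - \<beta> * norm y powr - real DIM('a) \<le> f y / norm (x - y) powr \<beta>"
    if "0 < norm y" "norm y \<le> 1" "y \<noteq> x" for y
  proof -
    have "norm (x - y) \<le> 2"
      using that assms norm_triangle_ineq4[of x y] by simp
    then have "2 powr - \<beta> \<le> norm (x - y) powr - \<beta>"
      using that assms by (intro powr_mono2') auto
    then have "c * norm y powr - real DIM('a) * 2 powr - \<beta> \<le> f y * norm (x - y) powr - \<beta>"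
      using f[OF that(1,2)] assms by (intro mult_mono order_trans[OF _ f[OF that(1,2)]]) auto
    then show ?thesis
      by (simp add: powr_minus_divide mult_ac)
  qed
  moreover have "0 < norm y \<and> norm y \<le> 1" if y: "y \<in> shell (1/2 * 2 powr (- 1 * real k))" for y :: 'a and k
  proof -
    have "0 < (2::real) powr (- 1 * real k)" "(2::real) powr (- 1 * real k) \<le> 1"
      using powr_mono[of "- 1 * real k" 0 "2::real"] by auto
    then show ?thesis
      using y unfolding shell_def by (auto simp del: zero_less_norm_iff)
  qed
  ultimately show "AE y in lborel. y \<in> (\<Union>k. shell (1/2 * 2 powr (- 1 * real k))) \<longrightarrow>
      ennreal (c * 2 powr - \<beta> * norm y powr - real DIM('a)) \<le> ennreal (f y / norm (x - y) powr \<beta>)"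
    using AE_lborel_singleton[of x] by (auto elim!: eventually_mono intro!: ennreal_leI)
qed (use assms in auto)

lemma ex_pos_ennreal_le:
  assumes "I \<noteq> 0"
  shows "\<exists>c>0. ennreal c \<le> I"
proof (cases I)
  case (real r)
  then show ?thesis
    using assms by (intro exI[of _ r]) auto
next
  case top
  then show ?thesis
    by (intro exI[of _ 1]) auto
qed

text \<open>Only the mass of f on \<open>shell 1\<close> is kept, where |x - y| \<le> |x| + 2. The
  constant c is chosen before x and m, so m may later be the factor |x|^(-\<gamma>) from the second
  equation.\<close>

lemma kernel_positive:
  fixes f :: "'a::euclidean_space \<Rightarrow> real"
  assumes meas: "f \<in> borel_measurable (lebesgue_on (UNIV - {0}))"
    and pos: "\<And>y. y \<noteq> 0 \<Longrightarrow> f y > 0" and "\<beta> \<ge> 0"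
  shows "\<exists>c>0. \<forall>x. \<forall>m\<ge>0. ennreal (c * m * (norm x + 2) powr - \<beta>)
      \<le> (\<integral>\<^sup>+y. ennreal (m * f y / norm (x - y) powr \<beta>) \<partial>lborel)"
proof -
  \<comment> \<open>f is measurable only off the origin; its extension by 0 is measurable on the
    whole space.\<close>
  let ?h = "\<lambda>y::'a. ennreal (if y \<in> UNIV - {0} then f y else 0) * indicator (shell 1) y"
  have "(\<lambda>y. if y \<in> UNIV - {0} then f y else 0) \<in> borel_measurable lebesgue"
    using meas by (subst borel_measurable_if) auto
  moreover have [measurable]: "shell 1 \<in> sets (lebesgue :: 'a measure)"
    using shell_borel by auto
  ultimately have h [measurable]: "?h \<in> borel_measurable lebesgue"
    by measurable
  have "(\<integral>\<^sup>+y. ?h y \<partial>lebesgue) \<noteq> 0"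
  proof
    assume "(\<integral>\<^sup>+y. ?h y \<partial>lebesgue) = 0"
    then have "AE y in lebesgue. ?h y = 0"
      using h by (subst (asm) nn_integral_0_iff_AE) auto
    \<comment> \<open>Since f > 0 on the shell, a vanishing integral would make the shell a null
      set.\<close>
    then have "AE y in lborel. y \<notin> (shell 1 :: 'a set)"
      unfolding AE_completion_iff
      by eventually_elim (use pos in \<open>auto simp: shell_def indicator_def split: if_splits\<close>, force)
    then have "emeasure lborel (shell 1 :: 'a set) = 0"
      by (simp add: AE_iff_measurable[of "shell 1"])
    then show False
      using shell_vol_pos[where 'a='a] by (simp add: emeasure_shell)
  qed
  then obtain c where c: "c > 0" "ennreal c \<le> (\<integral>\<^sup>+y. ?h y \<partial>lebesgue)"
    using ex_pos_ennreal_le by blast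
  show ?thesis
  proof (intro exI[of _ c] conjI c(1) allI impI)
    fix x :: 'a and m :: real assume m: "m \<ge> 0"
    have *: "m * (norm x + 2) powr - \<beta> * f y \<le> m * f y / norm (x - y) powr \<beta>"
      if "y \<in> shell 1" "y \<noteq> x" for y
    proof -
      have "norm (x - y) \<le> norm x + 2"
        using that norm_triangle_ineq4[of x y] by (simp add: shell_def)
      then have "(norm x + 2) powr - \<beta> \<le> norm (x - y) powr - \<beta>"
        using that assms by (intro powr_mono2') auto
      moreover have "y \<noteq> 0"
        using that by (auto simp: shell_def)
      ultimately have "(m * f y) * (norm x + 2) powr - \<beta> \<le> (m * f y) * norm (x - y) powr - \<beta>"
        using m pos[of y] by (intro mult_left_mono) auto
      then show ?thesis
        by (simp add: powr_minus_divide mult_ac)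
    qed
    have "ennreal (c * m * (norm x + 2) powr - \<beta>) = ennreal (m * (norm x + 2) powr - \<beta>) * ennreal c"
      using m c by (simp add: ennreal_mult'[symmetric] mult_ac)
    also have "\<dots> \<le> ennreal (m * (norm x + 2) powr - \<beta>) * (\<integral>\<^sup>+y. ?h y \<partial>lebesgue)"
      using c(2) by (rule mult_left_mono) simp
    also have "\<dots> = (\<integral>\<^sup>+y. ennreal (m * (norm x + 2) powr - \<beta>) * ?h y \<partial>lebesgue)"
      by (rule nn_integral_cmult[symmetric]) (rule h)
    also have "\<dots> \<le> (\<integral>\<^sup>+y. ennreal (m * f y / norm (x - y) powr \<beta>) \<partial>lebesgue)"
    proof (rule nn_integral_mono_AE, rule AE_completion)
      show "AE y in lborel. ennreal (m * (norm x + 2) powr - \<beta>) * ?h y \<le> ennreal (m * f y / norm (x - y) powr \<beta>)"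
        using AE_lborel_singleton[of x] AE_lborel_singleton[of 0]
        by eventually_elim (use m * pos in \<open>auto simp: indicator_def ennreal_mult'[symmetric] intro!: ennreal_leI\<close>)
    qed
    finally show "ennreal (c * m * (norm x + 2) powr - \<beta>)
      \<le> (\<integral>\<^sup>+y. ennreal (m * f y / norm (x - y) powr \<beta>) \<partial>lborel)"
      by (simp add: nn_integral_completion)
  qed
qed

lemma nn_integral_linear3:
  assumes [measurable]: "F \<in> borel_measurable M" "G \<in> borel_measurable M" "H \<in> borel_measurable M"
  shows "(\<integral>\<^sup>+y. a * F y + b * G y + c * H y \<partial>M)
    = a * (\<integral>\<^sup>+y. F y \<partial>M) + b * (\<integral>\<^sup>+y. G y \<partial>M) + c * (\<integral>\<^sup>+y. H y \<partial>M)"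
  by (simp add: nn_integral_add nn_integral_cmult)

text \<open>Each hypothesis secures convergence in one place: s < n at the origin, \<gamma> > 0
  (that is, n - \<gamma> < n) at y = x, and \<gamma> < s (that is, s + n - \<gamma> > n) at
  infinity. Cutting at radius R = |x|/2 around 0 and around x, all three pieces scale like
  R^(\<gamma> - s).\<close>

lemma kernel_power_upper:
  assumes "0 < \<gamma>" "\<gamma> < s" "s < real DIM('a::euclidean_space)"
  obtains C where "C > 0"
    "\<And>x::'a. x \<noteq> 0 \<Longrightarrow> (\<integral>\<^sup>+y. ennreal (norm y powr - s / norm (x - y) powr (real DIM('a) - \<gamma>)) \<partial>lborel)
      \<le> ennreal (C * norm x powr (\<gamma> - s))"
proof -
  define \<beta> where "\<beta> = real DIM('a) - \<gamma>"
  have \<beta>: "\<beta> > 0"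
    using assms by (simp add: \<beta>_def)
  let ?In = "\<lambda>R. \<Union>k. shell (R * 2 powr (- 1 * real k)) :: 'a set"
  let ?Out = "\<lambda>R. \<Union>k. shell (R * 2 powr (1 * real k)) :: 'a set"
  obtain C1 where C1: "C1 > 0"
    "\<And>R. R > 0 \<Longrightarrow> (\<integral>\<^sup>+y\<in>?In R. ennreal (norm y powr - s) \<partial>lborel) \<le> ennreal (C1 * R powr (real DIM('a) - s))"
    using shells_integral_upper[of s "-1", where 'a='a] assms by auto
  obtain C2 where C2: "C2 > 0"
    "\<And>R. R > 0 \<Longrightarrow> (\<integral>\<^sup>+y\<in>?In R. ennreal (norm y powr - \<beta>) \<partial>lborel) \<le> ennreal (C2 * R powr \<gamma>)"
    using shells_integral_upper[of \<beta> "-1", where 'a='a] assms by (auto simp: \<beta>_def)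
  obtain C3 where C3: "C3 > 0"
    "\<And>R. R > 0 \<Longrightarrow> (\<integral>\<^sup>+y\<in>?Out R. ennreal (norm y powr - (s + \<beta>)) \<partial>lborel) \<le> ennreal (C3 * R powr (\<gamma> - s))"
    using shells_integral_upper[of "s + \<beta>" "1", where 'a='a] assms \<beta> by (auto simp: \<beta>_def)
  \<comment> \<open>The last factor converts R^(\<gamma> - s) into |x|^(\<gamma> - s), as R =
    |x|/2.\<close>
  define C where "C = (C1 + C2 + 3 powr \<beta> * C3) * (1 / 2) powr (\<gamma> - s)"
  show thesis
  proof (rule that[of C])
    show "C > 0"
      using C1 C2 C3 by (auto simp: C_def intro!: mult_pos_pos add_pos_pos)
    fix x :: 'a assume x: "x \<noteq> 0"
    define R where "R = norm x / 2"
    have R: "R > 0"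
      using x by (simp add: R_def)
    \<comment> \<open>\<open>?A\<close>, \<open>?B\<close>, \<open>?D\<close> dominate the integrand for \<open>y\<close> near \<open>0\<close>, for \<open>y\<close> near \<open>x\<close>, and away
      from both, where \<open>|y| \<le> 3|x - y|\<close>.\<close>
    let ?A = "\<lambda>y. ennreal (R powr - \<beta>) * (ennreal (norm y powr - s) * indicator (?In R) y)"
    let ?h = "\<lambda>y. ennreal (norm y powr - \<beta>) * indicator (?In R) y"
    let ?B = "\<lambda>y. ennreal (R powr - s) * ?h (- x + y)"
    let ?D = "\<lambda>y. ennreal (3 powr \<beta>) * (ennreal (norm y powr - (s + \<beta>)) * indicator (?Out R) y)"
    have bound: "ennreal (norm y powr - s / norm (x - y) powr \<beta>) \<le> ?A y + ?B y + ?D y"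
      if "y \<noteq> 0" "y \<noteq> x" for y
    proof -
      consider "norm y < R" | "norm (- x + y) < R" | "R \<le> norm y" "R \<le> norm (- x + y)"
        by linarith
      then show ?thesis
      proof cases
        case 1
        have "R \<le> norm (x - y)"
          using 1 norm_triangle_ineq2[of x y] by (simp add: R_def)
        then have "norm (x - y) powr - \<beta> \<le> R powr - \<beta>"
          using R \<beta> by (intro powr_mono2') auto
        then have "norm y powr - s / norm (x - y) powr \<beta> \<le> R powr - \<beta> * norm y powr - s"
          using mult_right_mono[of "norm (x - y) powr - \<beta>" "R powr - \<beta>" "norm y powr - s"]
          by (simp add: powr_minus_divide[of _ \<beta>])
        moreover have "y \<in> ?In R"
          using 1 R that by (intro shells_inside) auto
        ultimately have "ennreal (norm y powr - s / norm (x - y) powr \<beta>) \<le> ?A y"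
          by (simp add: ennreal_mult'[symmetric] ennreal_leI)
        then show ?thesis
          by (simp add: add_increasing2 add.assoc)
      next
        case 2
        have "R \<le> norm y"
          using 2 norm_triangle_ineq2[of x y] by (simp add: R_def norm_minus_commute[of y x])
        then have "norm y powr - s \<le> R powr - s"
          using R assms by (intro powr_mono2') auto
        then have "norm y powr - s / norm (x - y) powr \<beta> \<le> R powr - s * norm (- x + y) powr - \<beta>"
          by (simp add: powr_minus_divide[of _ \<beta>] norm_minus_commute[of y x] divide_right_mono)
        moreover have "- x + y \<in> ?In R"
          using 2 R that by (intro shells_inside) auto
        ultimately have "ennreal (norm y powr - s / norm (x - y) powr \<beta>) \<le> ?B y"
          by (simp add: ennreal_mult'[symmetric] ennreal_leI)
        then show ?thesis
          by (simp add: add_increasing2 add_increasing)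
      next
        case 3
        \<comment> \<open>|y| \<le> |x - y| + |x|, and |x| = 2 R \<le> 2|x - y| in this
          case.\<close>
        have "norm y \<le> 3 * norm (x - y)"
          using 3 norm_triangle_ineq2[of y x] by (simp add: R_def norm_minus_commute[of y x])
        then have "(3 * norm (x - y)) powr - \<beta> \<le> norm y powr - \<beta>"
          using that \<beta> by (intro powr_mono2') auto
        then have "3 powr \<beta> * (3 * norm (x - y)) powr - \<beta> \<le> 3 powr \<beta> * norm y powr - \<beta>"
          by (rule mult_left_mono) simp
        moreover have "3 powr \<beta> * (3 * norm (x - y)) powr - \<beta> = norm (x - y) powr - \<beta>"
          by (simp add: powr_mult powr_minus)
        ultimately have "norm (x - y) powr - \<beta> \<le> 3 powr \<beta> * norm y powr - \<beta>"
          by simp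
        then have "norm y powr - s * norm (x - y) powr - \<beta> \<le> norm y powr - s * (3 powr \<beta> * norm y powr - \<beta>)"
          by (rule mult_left_mono) simp
        also have "\<dots> = 3 powr \<beta> * norm y powr - (s + \<beta>)"
          using that by (simp add: powr_diff powr_minus field_simps)
        finally have "norm y powr - s / norm (x - y) powr \<beta> \<le> 3 powr \<beta> * norm y powr - (s + \<beta>)"
          by (simp add: powr_minus_divide[of _ \<beta>])
        moreover have "y \<in> ?Out R"
          using 3 R by (intro shells_outside) auto
        ultimately have "ennreal (norm y powr - s / norm (x - y) powr \<beta>) \<le> ?D y"
          by (simp add: ennreal_mult'[symmetric] ennreal_leI)
        then show ?thesis
          by (simp add: add_increasing)
      qed
    qed
    have [measurable]: "?In R \<in> sets borel" "?Out R \<in> sets borel"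
      by (auto intro!: sets.countable_UN)
    have h [measurable]: "?h \<in> borel_measurable borel"
      by measurable
    have "(\<integral>\<^sup>+y. ennreal (norm y powr - s / norm (x - y) powr \<beta>) \<partial>lborel)
      \<le> (\<integral>\<^sup>+y. ?A y + ?B y + ?D y \<partial>lborel)"
      using AE_lborel_singleton[of x] AE_lborel_singleton[of 0]
      by (intro nn_integral_mono_AE, eventually_elim) (rule bound)
    also have "\<dots> = ennreal (R powr - \<beta>) * (\<integral>\<^sup>+y\<in>?In R. ennreal (norm y powr - s) \<partial>lborel)
       + ennreal (R powr - s) * (\<integral>\<^sup>+y. ?h (- x + y) \<partial>lborel)
       + ennreal (3 powr \<beta>) * (\<integral>\<^sup>+y\<in>?Out R. ennreal (norm y powr - (s + \<beta>)) \<partial>lborel)"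
      by (rule nn_integral_linear3) measurable
    \<comment> \<open>Translation invariance moves the singularity from x to the origin.\<close>
    also have "(\<integral>\<^sup>+y. ?h (- x + y) \<partial>lborel) = (\<integral>\<^sup>+y. ?h y \<partial>lborel)"
      using nn_integral_distr[of "(+) (- x)" lborel borel ?h] h by (simp only: lborel_distr_plus measurable_lborel2 borel_measurable_add borel_measurable_const measurable_ident_sets)
    also have "ennreal (R powr - \<beta>) * (\<integral>\<^sup>+y\<in>?In R. ennreal (norm y powr - s) \<partial>lborel)
       + ennreal (R powr - s) * (\<integral>\<^sup>+y. ?h y \<partial>lborel)
       + ennreal (3 powr \<beta>) * (\<integral>\<^sup>+y\<in>?Out R. ennreal (norm y powr - (s + \<beta>)) \<partial>lborel)
      \<le> ennreal (R powr - \<beta>) * ennreal (C1 * R powr (real DIM('a) - s))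
       + ennreal (R powr - s) * ennreal (C2 * R powr \<gamma>)
       + ennreal (3 powr \<beta>) * ennreal (C3 * R powr (\<gamma> - s))"
      by (intro add_mono mult_left_mono C1 C2 C3 R) auto
    also have "\<dots> = ennreal (R powr - \<beta> * (C1 * R powr (real DIM('a) - s)) + R powr - s * (C2 * R powr \<gamma>)
        + 3 powr \<beta> * (C3 * R powr (\<gamma> - s)))"
      using C1 C2 C3 by (simp add: ennreal_mult'[symmetric])
    also have "R powr - \<beta> * (C1 * R powr (real DIM('a) - s)) = C1 * R powr (\<gamma> - s)"
      by (simp add: \<beta>_def flip: powr_add)
    also have "R powr - s * (C2 * R powr \<gamma>) = C2 * R powr (\<gamma> - s)"
      by (simp flip: powr_add)
    also have "C1 * R powr (\<gamma> - s) + C2 * R powr (\<gamma> - s) + 3 powr \<beta> * (C3 * R powr (\<gamma> - s)) = C * norm x powr (\<gamma> - s)"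
      by (simp add: C_def R_def powr_divide algebra_simps add_divide_distrib)
    finally show "(\<integral>\<^sup>+y. ennreal (norm y powr - s / norm (x - y) powr (real DIM('a) - \<gamma>)) \<partial>lborel)
      \<le> ennreal (C * norm x powr (\<gamma> - s))"
      by (simp add: \<beta>_def)
  qed
qed

subsection \<open>The system\<close>

text \<open>Here and in \<open>rhs2_eq\<close> the integral is put into the form f(y)/|x -
  y|^\<beta> over \<open>lborel\<close> with \<beta> = n - \<gamma>, the form of the kernel
  lemmas.\<close>

lemma rhs1_eq:
  fixes v :: "real ^ 'n \<Rightarrow> real"
  shows "rhs1 \<gamma> q v x = (\<integral>\<^sup>+y. ennreal ((v y powr q / norm y powr \<gamma>) / norm (x - y) powr (real DIM(real ^ 'n) - \<gamma>)) \<partial>lborel)"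
  unfolding rhs1_def nn_integral_completion by (simp add: mult.commute)

lemma rhs2_eq:
  fixes u :: "real ^ 'n \<Rightarrow> real"
  shows "rhs2 \<gamma> q u x = (\<integral>\<^sup>+y. ennreal ((norm x powr - \<gamma> * u y powr q) / norm (x - y) powr (real DIM(real ^ 'n) - \<gamma>)) \<partial>lborel)"
  unfolding rhs2_def nn_integral_completion by (simp add: powr_minus_divide mult.commute)

text \<open>On the shell the weight |y|^(-\<gamma>) is comparable to |x|^(-\<gamma>) and cancels the
  factor |x|^\<gamma> from \<open>kernel_lower\<close>; the powers of 2 in K come from |y| \<le>
  2|x|. Requiring the bound on v only on the shell of x lets the lemma apply when v is controlled
  only for |y| \<ge> 1.\<close>

lemma rhs1_lower_power:
  fixes v :: "real ^ 'n \<Rightarrow> real"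
  assumes "0 < \<gamma>" "\<gamma> < real CARD('n)" "k > 0" "b \<ge> 0" "q > 0"
  obtains K where "K > 0"
    "\<And>x. x \<noteq> 0 \<Longrightarrow> (\<And>y. y \<in> shell (norm x) \<Longrightarrow> k * norm y powr - b \<le> v y) \<Longrightarrow>
      ennreal (K * norm x powr - (b * q)) \<le> rhs1 \<gamma> q v x"
proof -
  define K0 where "K0 = shell_vol TYPE(real ^ 'n) * 3 powr - (real DIM(real ^ 'n) - \<gamma>)"
  define K where "K = K0 * (k powr q * 2 powr - (b * q) * 2 powr - \<gamma>)"
  show thesis
  proof (rule that)
    show "K > 0"
      using shell_vol_pos assms by (auto simp: K_def K0_def intro!: mult_pos_pos)
    fix x :: "real ^ 'n"
    assume x: "x \<noteq> 0" and v: "\<And>y. y \<in> shell (norm x) \<Longrightarrow> k * norm y powr - b \<le> v y"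
    let ?m = "(k * (2 * norm x) powr - b) powr q * (2 * norm x) powr - \<gamma>"
    have "?m \<le> v y powr q / norm y powr \<gamma>" if y: "y \<in> shell (norm x)" for y
    proof -
      have ny: "norm y > 0" "norm y \<le> 2 * norm x"
        using y x by (auto simp: shell_def)
      then have "(2 * norm x) powr - b \<le> norm y powr - b"
        using assms by (intro powr_mono2') auto
      then have "k * (2 * norm x) powr - b \<le> v y"
        using v[OF y] assms by (intro order_trans[OF mult_left_mono v[OF y]]) auto
      then have "(k * (2 * norm x) powr - b) powr q \<le> v y powr q"
        using assms by (intro powr_mono2) auto
      moreover have "(2 * norm x) powr - \<gamma> \<le> norm y powr - \<gamma>"
        using ny assms by (intro powr_mono2') auto
      ultimately have "?m \<le> v y powr q * norm y powr - \<gamma>"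
        by (intro mult_mono) auto
      then show ?thesis
        by (simp add: powr_minus_divide)
    qed
    then have "ennreal (K0 * ?m * norm x powr (real DIM(real ^ 'n) - (real DIM(real ^ 'n) - \<gamma>))) \<le> rhs1 \<gamma> q v x"
      unfolding rhs1_eq K0_def using x assms by (intro kernel_lower) auto
    moreover have "(k * (2 * norm x) powr - b) powr q = k powr q * (2 powr - (b * q) * norm x powr - (b * q))"
      using assms by (simp add: powr_mult powr_powr)
    then have "K0 * ?m * norm x powr (real DIM(real ^ 'n) - (real DIM(real ^ 'n) - \<gamma>)) = K * norm x powr - (b * q)"
      using x by (simp add: K_def powr_mult powr_minus field_simps)
    ultimately show "ennreal (K * norm x powr - (b * q)) \<le> rhs1 \<gamma> q v x"
      by simp
  qed
qed

text \<open>As for the first equation, except that |x|^(-\<gamma>) is already a factor outside the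
  integral.\<close>

lemma rhs2_lower_power:
  fixes u :: "real ^ 'n \<Rightarrow> real"
  assumes "0 < \<gamma>" "\<gamma> < real CARD('n)" "k > 0" "a \<ge> 0" "q > 0"
  obtains K where "K > 0"
    "\<And>x. x \<noteq> 0 \<Longrightarrow> (\<And>y. y \<in> shell (norm x) \<Longrightarrow> k * norm y powr - a \<le> u y) \<Longrightarrow>
      ennreal (K * norm x powr - (a * q)) \<le> rhs2 \<gamma> q u x"
proof -
  define K0 where "K0 = shell_vol TYPE(real ^ 'n) * 3 powr - (real DIM(real ^ 'n) - \<gamma>)"
  define K where "K = K0 * (k powr q * 2 powr - (a * q))"
  show thesis
  proof (rule that)
    show "K > 0"
      using shell_vol_pos assms by (auto simp: K_def K0_def intro!: mult_pos_pos)
    fix x :: "real ^ 'n"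
    assume x: "x \<noteq> 0" and u: "\<And>y. y \<in> shell (norm x) \<Longrightarrow> k * norm y powr - a \<le> u y"
    let ?m = "norm x powr - \<gamma> * (k * (2 * norm x) powr - a) powr q"
    have "?m \<le> norm x powr - \<gamma> * u y powr q" if y: "y \<in> shell (norm x)" for y
    proof -
      have "norm y > 0" "norm y \<le> 2 * norm x"
        using y x by (auto simp: shell_def)
      then have "(2 * norm x) powr - a \<le> norm y powr - a"
        using assms by (intro powr_mono2') auto
      then have "k * (2 * norm x) powr - a \<le> u y"
        using assms by (intro order_trans[OF mult_left_mono u[OF y]]) auto
      then have "(k * (2 * norm x) powr - a) powr q \<le> u y powr q"
        using assms by (intro powr_mono2) auto
      then show ?thesis
        by (rule mult_left_mono) simp
    qed
    then have "ennreal (K0 * ?m * norm x powr (real DIM(real ^ 'n) - (real DIM(real ^ 'n) - \<gamma>))) \<le> rhs2 \<gamma> q u x"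
      unfolding rhs2_eq K0_def using x assms by (intro kernel_lower) auto
    moreover have "(k * (2 * norm x) powr - a) powr q = k powr q * (2 powr - (a * q) * norm x powr - (a * q))"
      using assms by (simp add: powr_mult powr_powr)
    then have "K0 * ?m * norm x powr (real DIM(real ^ 'n) - (real DIM(real ^ 'n) - \<gamma>)) = K * norm x powr - (a * q)"
      using x by (simp add: K_def powr_mult powr_minus field_simps)
    ultimately show "ennreal (K * norm x powr - (a * q)) \<le> rhs2 \<gamma> q u x"
      by simp
  qed
qed

text \<open>The weight |y|^(-\<gamma>) raises the exponent of the density to s = b q + \<gamma> in
  \<open>kernel_power_upper\<close>.\<close>

lemma rhs1_upper_power:
  assumes "0 < \<gamma>" "0 < b * q" "\<gamma> + b * q < real CARD('n)"
  obtains C where "C > 0"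
    "\<And>x::real ^ 'n. x \<noteq> 0 \<Longrightarrow> rhs1 \<gamma> q (\<lambda>y. norm y powr - b) x \<le> ennreal (C * norm x powr - (b * q))"
proof -
  obtain C where C: "C > 0" "\<And>x::real ^ 'n. x \<noteq> 0 \<Longrightarrow>
      (\<integral>\<^sup>+y. ennreal (norm y powr - (b * q + \<gamma>) / norm (x - y) powr (real DIM(real ^ 'n) - \<gamma>)) \<partial>lborel)
      \<le> ennreal (C * norm x powr (\<gamma> - (b * q + \<gamma>)))"
    using kernel_power_upper[of \<gamma> "b * q + \<gamma>", where 'a = "real ^ 'n"] assms by auto
  have "(norm y powr - b) powr q / norm y powr \<gamma> = norm y powr - (b * q + \<gamma>)" for y :: "real ^ 'n"
    by (simp add: powr_powr powr_diff)
  then show thesis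
    using C by (intro that[of C]) (simp_all add: rhs1_eq)
qed

lemma rhs2_upper_power:
  assumes "0 < \<gamma>" "\<gamma> < a * q" "a * q < real CARD('n)"
  obtains C where "C > 0"
    "\<And>x::real ^ 'n. x \<noteq> 0 \<Longrightarrow> rhs2 \<gamma> q (\<lambda>y. norm y powr - a) x \<le> ennreal (C * norm x powr - (a * q))"
proof -
  obtain C where C: "C > 0" "\<And>x::real ^ 'n. x \<noteq> 0 \<Longrightarrow>
      (\<integral>\<^sup>+y. ennreal (norm y powr - (a * q) / norm (x - y) powr (real DIM(real ^ 'n) - \<gamma>)) \<partial>lborel)
      \<le> ennreal (C * norm x powr (\<gamma> - a * q))"
    using kernel_power_upper[of \<gamma> "a * q", where 'a = "real ^ 'n"] assms by auto
  show thesis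
  proof (rule that[OF C(1)])
    fix x :: "real ^ 'n" assume x: "x \<noteq> 0"
    let ?I = "\<lambda>y. norm y powr - (a * q) / norm (x - y) powr (real DIM(real ^ 'n) - \<gamma>)"
    have "rhs2 \<gamma> q (\<lambda>y. norm y powr - a) x = (\<integral>\<^sup>+y. ennreal (norm x powr - \<gamma>) * ennreal (?I y) \<partial>lborel)"
      by (simp add: rhs2_eq powr_powr flip: ennreal_mult')
    also have "\<dots> = ennreal (norm x powr - \<gamma>) * (\<integral>\<^sup>+y. ennreal (?I y) \<partial>lborel)"
      by (rule nn_integral_cmult) measurable
    also have "\<dots> \<le> ennreal (norm x powr - \<gamma>) * ennreal (C * norm x powr (\<gamma> - a * q))"
      by (intro mult_left_mono C x) simp
    also have "\<dots> = ennreal (C * norm x powr - (a * q))"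
      by (simp add: ennreal_mult'[symmetric] mult.left_commute flip: powr_add)
    finally show "rhs2 \<gamma> q (\<lambda>y. norm y powr - a) x \<le> ennreal (C * norm x powr - (a * q))" .
  qed
qed

section \<open>Lower bounds for super solutions and nonexistence\<close>

locale super_solution =
  fixes \<gamma> q1 q2 c1 c2 :: real and u v :: "real ^ 'n \<Rightarrow> real"
  assumes \<gamma>: "0 < \<gamma>" "\<gamma> < real CARD('n)"
    and q: "q1 > 0" "q2 > 0" and c: "c1 > 0" "c2 > 0"
    and pos: "\<And>x. x \<noteq> 0 \<Longrightarrow> 0 < u x" "\<And>x. x \<noteq> 0 \<Longrightarrow> 0 < v x"
    and meas: "u \<in> borel_measurable (lebesgue_on (UNIV - {0}))" "v \<in> borel_measurable (lebesgue_on (UNIV - {0}))"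
    and super: "\<And>x. x \<noteq> 0 \<Longrightarrow> ennreal c1 * rhs1 \<gamma> q2 v x \<le> ennreal (u x)"
      "\<And>x. x \<noteq> 0 \<Longrightarrow> ennreal c2 * rhs2 \<gamma> q1 u x \<le> ennreal (v x)"
begin

lemma u_ge:
  assumes "x \<noteq> 0" "ennreal k \<le> rhs1 \<gamma> q2 v x"
  shows "c1 * k \<le> u x"
proof -
  have "ennreal (c1 * k) \<le> ennreal (u x)"
    using c order_trans[OF mult_left_mono[OF assms(2)] super(1)[OF assms(1)]] by (simp add: ennreal_mult')
  then show ?thesis
    using pos(1)[OF assms(1)] by (simp add: ennreal_le_iff)
qed

lemma v_ge:
  assumes "x \<noteq> 0" "ennreal k \<le> rhs2 \<gamma> q1 u x"
  shows "c2 * k \<le> v x"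
proof -
  have "ennreal (c2 * k) \<le> ennreal (v x)"
    using c order_trans[OF mult_left_mono[OF assms(2)] super(2)[OF assms(1)]] by (simp add: ennreal_mult')
  then show ?thesis
    using pos(2)[OF assms(1)] by (simp add: ennreal_le_iff)
qed

text \<open>u and v are real valued and c1, c2 positive; the divergence arguments below contradict
  this finiteness.\<close>

lemma rhs_finite:
  assumes "x \<noteq> 0"
  shows "rhs1 \<gamma> q2 v x \<noteq> \<infinity>" "rhs2 \<gamma> q1 u x \<noteq> \<infinity>"
  using super[OF assms] c by (auto simp: ennreal_mult_top top_unique)

text \<open>\<open>kernel_positive\<close> with m = 1, together with |x| + 2 \<le> 3|x| for |x|
  \<ge> 1.\<close>

lemma u_lower_at_infinity:
  obtains k where "k > 0" "\<And>x. norm x \<ge> 1 \<Longrightarrow> k * norm x powr - (real CARD('n) - \<gamma>) \<le> u x"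
proof -
  let ?\<beta> = "real DIM(real ^ 'n) - \<gamma>"
  have "(\<lambda>y. v y powr q2 / norm y powr \<gamma>) \<in> borel_measurable (lebesgue_on (UNIV - {0}))"
    using meas(2)
    by (intro borel_measurable_divide powr_real_measurable continuous_imp_measurable_on_sets_lebesgue[of _ norm]
        continuous_intros) auto
  moreover have "v y powr q2 / norm y powr \<gamma> > 0" if "y \<noteq> 0" for y
    using pos(2)[OF that] that by simp
  moreover have "?\<beta> \<ge> 0"
    using \<gamma> by simp
  ultimately obtain d where d: "d > 0" "\<And>x m. m \<ge> 0 \<Longrightarrow> ennreal (d * m * (norm x + 2) powr - ?\<beta>)
      \<le> (\<integral>\<^sup>+y. ennreal (m * (v y powr q2 / norm y powr \<gamma>) / norm (x - y) powr ?\<beta>) \<partial>lborel)"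
    using kernel_positive[of "\<lambda>y. v y powr q2 / norm y powr \<gamma>" ?\<beta>] by blast
  show thesis
  proof (rule that)
    show "c1 * d * 3 powr - ?\<beta> > 0"
      using c d by simp
    fix x :: "real ^ 'n" assume x: "norm x \<ge> 1"
    have "ennreal (d * (norm x + 2) powr - ?\<beta>) \<le> rhs1 \<gamma> q2 v x"
      using d(2)[of 1 x] by (simp add: rhs1_eq)
    moreover have "x \<noteq> 0"
      using x by auto
    ultimately have "c1 * (d * (norm x + 2) powr - ?\<beta>) \<le> u x"
      by (intro u_ge)
    moreover have "(3 * norm x) powr - ?\<beta> \<le> (norm x + 2) powr - ?\<beta>"
      using x \<gamma> by (intro powr_mono2') auto
    then have "c1 * (d * (3 * norm x) powr - ?\<beta>) \<le> c1 * (d * (norm x + 2) powr - ?\<beta>)"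
      using c d by (intro mult_left_mono) auto
    ultimately show "c1 * d * 3 powr - ?\<beta> * norm x powr - (real CARD('n) - \<gamma>) \<le> u x"
      by (simp add: powr_mult mult_ac)
  qed
qed

text \<open>\<open>kernel_positive\<close> with m = |x|^(-\<gamma>), together with |x| + 2 \<le> 3
  for |x| \<le> 1.\<close>

lemma v_lower_at_zero:
  obtains k where "k > 0" "\<And>x. 0 < norm x \<Longrightarrow> norm x \<le> 1 \<Longrightarrow> k * norm x powr - \<gamma> \<le> v x"
proof -
  let ?\<beta> = "real DIM(real ^ 'n) - \<gamma>"
  have "(\<lambda>y. u y powr q1) \<in> borel_measurable (lebesgue_on (UNIV - {0}))"
    using meas(1) by measurable
  moreover have "u y powr q1 > 0" if "y \<noteq> 0" for y
    using pos(1)[OF that] by simp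
  moreover have "?\<beta> \<ge> 0"
    using \<gamma> by simp
  ultimately obtain d where d: "d > 0" "\<And>x m. m \<ge> 0 \<Longrightarrow> ennreal (d * m * (norm x + 2) powr - ?\<beta>)
      \<le> (\<integral>\<^sup>+y. ennreal (m * (u y powr q1) / norm (x - y) powr ?\<beta>) \<partial>lborel)"
    using kernel_positive[of "\<lambda>y. u y powr q1" ?\<beta>] by blast
  show thesis
  proof (rule that)
    show "c2 * d * 3 powr - ?\<beta> > 0"
      using c d by simp
    fix x :: "real ^ 'n" assume x: "0 < norm x" "norm x \<le> 1"
    have "ennreal (d * norm x powr - \<gamma> * (norm x + 2) powr - ?\<beta>) \<le> rhs2 \<gamma> q1 u x"
      using d(2)[of "norm x powr - \<gamma>" x] by (simp add: rhs2_eq)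
    moreover have "x \<noteq> 0"
      using x by auto
    ultimately have "c2 * (d * norm x powr - \<gamma> * (norm x + 2) powr - ?\<beta>) \<le> v x"
      by (intro v_ge)
    moreover have "3 powr - ?\<beta> \<le> (norm x + 2) powr - ?\<beta>"
      using x \<gamma> by (intro powr_mono2') (simp_all add: add_nonneg_pos)
    then have "c2 * (d * norm x powr - \<gamma> * 3 powr - ?\<beta>) \<le> c2 * (d * norm x powr - \<gamma> * (norm x + 2) powr - ?\<beta>)"
      using c d by (intro mult_left_mono) auto
    ultimately show "c2 * d * 3 powr - ?\<beta> * norm x powr - \<gamma> \<le> v x"
      by (simp add: mult_ac)
  qed
qed

text \<open>The exponent passes from a to a q1 for v and then to a q1 q2 for u. The region |x| \<ge>
  1 is preserved because the shell of x points outwards.\<close>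

lemma power_bound_step:
  assumes "k > 0" "a \<ge> 0" and k: "\<And>x. norm x \<ge> 1 \<Longrightarrow> k * norm x powr - a \<le> u x"
  obtains k' where "k' > 0" "\<And>x. norm x \<ge> 1 \<Longrightarrow> k' * norm x powr - (a * (q1 * q2)) \<le> u x"
proof -
  have shell_ge: "norm y \<ge> 1" if "y \<in> shell (norm x)" "norm x \<ge> 1" for x y :: "real ^ 'n"
    using that by (simp add: shell_def)
  obtain K where K: "K > 0" "\<And>x. x \<noteq> 0 \<Longrightarrow> (\<And>y. y \<in> shell (norm x) \<Longrightarrow> k * norm y powr - a \<le> u y) \<Longrightarrow>
      ennreal (K * norm x powr - (a * q1)) \<le> rhs2 \<gamma> q1 u x"
    using rhs2_lower_power[OF \<gamma> assms(1,2) q(1)] by blast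
  have v: "c2 * K * norm x powr - (a * q1) \<le> v x" if "norm x \<ge> 1" for x
  proof -
    have "x \<noteq> 0"
      using that by auto
    then show ?thesis
      using v_ge[OF _ K(2)] k shell_ge that by (simp add: mult.assoc)
  qed
  obtain L where L: "L > 0" "\<And>x. x \<noteq> 0 \<Longrightarrow> (\<And>y. y \<in> shell (norm x) \<Longrightarrow> c2 * K * norm y powr - (a * q1) \<le> v y) \<Longrightarrow>
      ennreal (L * norm x powr - (a * q1 * q2)) \<le> rhs1 \<gamma> q2 v x"
    using rhs1_lower_power[OF \<gamma>, of "c2 * K" "a * q1" q2 v] c K q assms(2) by auto
  have "c1 * L * norm x powr - (a * (q1 * q2)) \<le> u x" if "norm x \<ge> 1" for x
  proof -
    have "x \<noteq> 0"
      using that by auto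
    then show ?thesis
      using u_ge[OF _ L(2)] v shell_ge that by (simp add: mult.assoc)
  qed
  then show thesis
    using that[of "c1 * L"] c L by simp
qed

text \<open>At a point with |x| = 1, u^q1 is at least a multiple of |y|^(-\<gamma>) for |y| \<ge> 1;
  with the kernel of order |y|^(\<gamma> - n) this reaches the critical decay |y|^(-n).\<close>

lemma no_slow_decay:
  assumes "k > 0" "a * q1 \<le> \<gamma>" and k: "\<And>x. norm x \<ge> 1 \<Longrightarrow> k * norm x powr - a \<le> u x"
  shows False
proof -
  obtain x :: "real ^ 'n" where x: "norm x = 1"
    using vector_choose_size[of 1] by auto
  have "k powr q1 * norm y powr ((real DIM(real ^ 'n) - \<gamma>) - real DIM(real ^ 'n)) \<le> norm x powr - \<gamma> * u y powr q1"
    if "norm y \<ge> 1" for y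
  proof -
    have "norm y powr - \<gamma> \<le> norm y powr (- a * q1)"
      using that assms by (intro powr_mono) auto
    then have "k powr q1 * norm y powr - \<gamma> \<le> k powr q1 * norm y powr (- a * q1)"
      by (rule mult_left_mono) simp
    also have "\<dots> = (k * norm y powr - a) powr q1"
      using assms by (simp add: powr_mult powr_powr)
    also have "\<dots> \<le> u y powr q1"
      using k[OF that] assms q by (intro powr_mono2) auto
    finally show ?thesis
      using x by simp
  qed
  then have "rhs2 \<gamma> q1 u x = \<infinity>"
    unfolding rhs2_eq using \<gamma> x assms by (intro kernel_infinite_outside[of _ _ "k powr q1"]) auto
  then show False
    using rhs_finite(2)[of x] x by (metis norm_zero zero_neq_one)
qed

text \<open>Near the origin v^q2 |y|^(-\<gamma>) is at least a multiple of |y|^(-\<gamma> (q2 + 1)),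
  and the hypothesis says \<gamma> (q2 + 1) \<ge> n, which is not integrable there.\<close>

lemma no_solution_q2:
  assumes "q2 \<ge> (real CARD('n) - \<gamma>) / \<gamma>"
  shows False
proof -
  obtain k where k: "k > 0" "\<And>x. 0 < norm x \<Longrightarrow> norm x \<le> 1 \<Longrightarrow> k * norm x powr - \<gamma> \<le> v x"
    using v_lower_at_zero by blast
  obtain x :: "real ^ 'n" where x: "norm x = 1"
    using vector_choose_size[of 1] by auto
  have "k powr q2 * norm y powr - real DIM(real ^ 'n) \<le> v y powr q2 / norm y powr \<gamma>"
    if y: "0 < norm y" "norm y \<le> 1" for y
  proof -
    have "norm y powr - (real DIM(real ^ 'n) - \<gamma>) \<le> norm y powr (- \<gamma> * q2)"
      using y assms \<gamma> by (intro powr_mono') (auto simp: field_simps)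
    then have "k powr q2 * norm y powr - (real DIM(real ^ 'n) - \<gamma>) \<le> k powr q2 * norm y powr (- \<gamma> * q2)"
      by (rule mult_left_mono) simp
    also have "\<dots> = (k * norm y powr - \<gamma>) powr q2"
      using k by (simp add: powr_mult powr_powr)
    also have "\<dots> \<le> v y powr q2"
      using k(2)[OF y] k(1) q by (intro powr_mono2) auto
    finally have "k powr q2 * norm y powr - (real DIM(real ^ 'n) - \<gamma>) / norm y powr \<gamma> \<le> v y powr q2 / norm y powr \<gamma>"
      by (rule divide_right_mono) simp
    then show ?thesis
      using y by (simp add: powr_diff powr_minus field_simps)
  qed
  then have "rhs1 \<gamma> q2 v x = \<infinity>"
    unfolding rhs1_eq using \<gamma> x k by (intro kernel_infinite_inside[of _ _ "k powr q2"]) auto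
  then show False
    using rhs_finite(1)[of x] x by (metis norm_zero zero_neq_one)
qed

lemma no_solution_q1:
  assumes "q1 \<le> \<gamma> / (real CARD('n) - \<gamma>)"
  shows False
proof -
  have "(real CARD('n) - \<gamma>) * q1 \<le> \<gamma>"
    using assms \<gamma> by (simp add: field_simps)
  then show False
    using u_lower_at_infinity no_slow_decay by metis
qed

lemma no_solution_product:
  assumes "q1 * q2 < 1"
  shows False
proof -
  let ?\<beta> = "real CARD('n) - \<gamma>"
  have \<beta>: "?\<beta> > 0"
    using \<gamma> by simp
  \<comment> \<open>The constant k may depend on j, since only one sufficiently large j is
    used.\<close>
  have bounds: "\<exists>k>0. \<forall>x. norm x \<ge> 1 \<longrightarrow> k * norm x powr - (?\<beta> * (q1 * q2) ^ j) \<le> u x" for j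
  proof (induction j)
    case 0
    then show ?case
      using u_lower_at_infinity by (metis mult.right_neutral power_0)
  next
    case (Suc j)
    then obtain k where "k > 0" "\<And>x. norm x \<ge> 1 \<Longrightarrow> k * norm x powr - (?\<beta> * (q1 * q2) ^ j) \<le> u x"
      by blast
    moreover have "?\<beta> * (q1 * q2) ^ j \<ge> 0"
      using \<beta> q by simp
    ultimately obtain k' where "k' > 0" "\<And>x. norm x \<ge> 1 \<Longrightarrow> k' * norm x powr - (?\<beta> * (q1 * q2) ^ j * (q1 * q2)) \<le> u x"
      by (blast elim: power_bound_step)
    then show ?case
      by (auto simp: mult_ac)
  qed
  have "\<gamma> / (?\<beta> * q1) > 0"
    using \<gamma> \<beta> q by simp
  \<comment> \<open>This choice makes the exponent a = (n - \<gamma>) (q1 q2)^j satisfy a q1 \<le>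
    \<gamma>.\<close>
  then obtain j where "(q1 * q2) ^ j < \<gamma> / (?\<beta> * q1)"
    using real_arch_pow_inv assms by blast
  then have "?\<beta> * (q1 * q2) ^ j * q1 \<le> \<gamma>"
    using \<beta> q by (simp add: field_simps)
  then show False
    using bounds[of j] no_slow_decay by blast
qed

end

lemma no_super_solution:
  fixes u v :: "real ^ 'n \<Rightarrow> real"
  assumes "0 < \<gamma>" "\<gamma> < real CARD('n)" "q1 > 0" "q2 > 0"
    and cond: "q1 * q2 < 1 \<or> q1 \<le> \<gamma> / (real CARD('n) - \<gamma>) \<or> q2 \<ge> (real CARD('n) - \<gamma>) / \<gamma>"
    and "pos_super_solution \<gamma> q1 q2 u v" "u \<in> Linfty_loc" "v \<in> Linfty_loc"
  shows False
proof -
  obtain c1 c2 where "c1 > 0" "c2 > 0"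
    "\<And>x. x \<noteq> 0 \<Longrightarrow> ennreal c1 * rhs1 \<gamma> q2 v x \<le> ennreal (u x)"
    "\<And>x. x \<noteq> 0 \<Longrightarrow> ennreal c2 * rhs2 \<gamma> q1 u x \<le> ennreal (v x)"
    using assms(6) unfolding pos_super_solution_def by blast
  then have "super_solution \<gamma> q1 q2 c1 c2 u v"
    using assms by unfold_locales (auto simp: pos_super_solution_def Linfty_loc_def)
  then show False
    using cond super_solution.no_solution_product[of \<gamma> q1 q2 c1 c2 u v]
      super_solution.no_solution_q1[of \<gamma> q1 q2 c1 c2 u v] super_solution.no_solution_q2[of \<gamma> q1 q2 c1 c2 u v]
    by blast
qed

section \<open>Power solutions in the case q1 q2 = 1\<close>

lemma norm_powr_Linfty_loc: "(\<lambda>x::real ^ 'n. norm x powr - a) \<in> Linfty_loc"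
proof -
  have cont: "continuous_on (UNIV - {0}) (\<lambda>x::real ^ 'n. norm x powr - a)"
    by (intro continuous_intros) auto
  then have "(\<lambda>x::real ^ 'n. norm x powr - a) \<in> borel_measurable (lebesgue_on (UNIV - {0}))"
    by (intro continuous_imp_measurable_on_sets_lebesgue) auto
  moreover have "bounded ((\<lambda>x. norm x powr - a) ` K)" if "compact K" "K \<subseteq> UNIV - {0}" for K :: "(real ^ 'n) set"
    using that cont by (intro compact_imp_bounded compact_continuous_image) (auto intro: continuous_on_subset)
  ultimately show ?thesis
    by (simp add: Linfty_loc_def)
qed

lemma norm_powr_radially_decreasing:
  assumes "a > 0"
  shows "radially_decreasing (\<lambda>x. norm x powr - a)"
  unfolding radially_decreasing_def
  using assms by (intro exI[of _ "\<lambda>r. r powr - a"]) (auto intro!: monotone_onI powr_less_mono2_neg)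

text \<open>Since a q1 q2 = a, the two integrals reproduce the exponents of u and v. The first
  converges because \<gamma> + a < n, the second because \<gamma> < a q1 < n.\<close>

lemma power_solution:
  fixes u v :: "real ^ 'n \<Rightarrow> real"
  assumes "0 < \<gamma>" "\<gamma> < real CARD('n)" "q1 > 0" "q2 > 0" "q1 * q2 = 1" "a > 0"
    and a: "a < real CARD('n) - \<gamma>" "\<gamma> < a * q1" "a * q1 < real CARD('n)"
    and u_def: "u = (\<lambda>x. norm x powr - a)" and v_def: "v = (\<lambda>x. norm x powr - (a * q1))"
  shows "pos_super_solution \<gamma> q1 q2 u v" "pos_lower_solution \<gamma> q1 q2 u v"
proof -
  have aqq: "a * q1 * q2 = a"
    using assms by (simp add: mult.assoc)
  obtain C1 where C1: "C1 > 0" "\<And>x. x \<noteq> 0 \<Longrightarrow> rhs1 \<gamma> q2 v x \<le> ennreal (C1 * u x)"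
    using rhs1_upper_power[of \<gamma> "a * q1" q2, where 'n = 'n] assms(1,6) a unfolding aqq u_def v_def by auto
  obtain C2 where C2: "C2 > 0" "\<And>x. x \<noteq> 0 \<Longrightarrow> rhs2 \<gamma> q1 u x \<le> ennreal (C2 * v x)"
    using rhs2_upper_power[of \<gamma> a q1, where 'n = 'n] assms(1) a unfolding u_def v_def by auto
  \<comment> \<open>The lower bounds apply with k = 1, their hypothesis on the shell being an
    equality.\<close>
  obtain K1 where K1: "K1 > 0" "\<And>x. x \<noteq> 0 \<Longrightarrow> ennreal (K1 * u x) \<le> rhs1 \<gamma> q2 v x"
    using rhs1_lower_power[of \<gamma> 1 "a * q1" q2 v] assms(1-4,6) unfolding aqq u_def v_def by auto
  obtain K2 where K2: "K2 > 0" "\<And>x. x \<noteq> 0 \<Longrightarrow> ennreal (K2 * v x) \<le> rhs2 \<gamma> q1 u x"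
    using rhs2_lower_power[of \<gamma> 1 a q1 u] assms(1-4,6) unfolding u_def v_def by auto
  have pos: "0 < u x \<and> 0 < v x" if "x \<noteq> 0" for x
    using that by (simp add: u_def v_def)
  have upper: "ennreal (1 / C) * I \<le> ennreal w" if "C > 0" "I \<le> ennreal (C * w)" for C w I
    using mult_left_mono[OF that(2), of "ennreal (1 / C)"] that(1) by (simp flip: ennreal_mult')
  have lower: "ennreal w \<le> ennreal (1 / K) * I" if "K > 0" "ennreal (K * w) \<le> I" for K w I
    using mult_left_mono[OF that(2), of "ennreal (1 / K)"] that(1) by (simp flip: ennreal_mult')
  show "pos_super_solution \<gamma> q1 q2 u v"
    unfolding pos_super_solution_def
    using pos C1 C2 upper by (intro conjI exI[of _ "1 / C1"] exI[of _ "1 / C2"]) auto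
  have "rhs1 \<gamma> q2 v x < \<infinity> \<and> rhs2 \<gamma> q1 u x < \<infinity>" if "x \<noteq> 0" for x
    using C1(2)[OF that] C2(2)[OF that] by (auto simp: le_less_trans[OF _ ennreal_less_top])
  then show "pos_lower_solution \<gamma> q1 q2 u v"
    unfolding pos_lower_solution_def
    using pos K1 K2 lower by (intro conjI exI[of _ "1 / K1"] exI[of _ "1 / K2"]) auto
qed

lemma ex_power_solution:
  assumes "0 < \<gamma>" "\<gamma> < real CARD('n)" "q1 > 0" "q2 > 0" "q1 * q2 = 1"
    and cond: "q1 > \<gamma> / (real CARD('n) - \<gamma>) \<or> q2 < (real CARD('n) - \<gamma>) / \<gamma>"
  obtains u v :: "real ^ 'n \<Rightarrow> real"
  where "pos_super_solution \<gamma> q1 q2 u v" "pos_lower_solution \<gamma> q1 q2 u v"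
    "radially_decreasing u" "radially_decreasing v" "u \<in> Linfty_loc" "v \<in> Linfty_loc"
proof -
  have q2: "q2 = 1 / q1"
    using assms by (simp add: field_simps)
  \<comment> \<open>As q2 = 1/q1, both alternatives in \<open>cond\<close> are equivalent to this
    inequality, which together with \<gamma> < n leaves room for the exponent a.\<close>
  have "\<gamma> / q1 < real CARD('n) - \<gamma>"
    using assms(1-3) cond unfolding q2 by (auto simp: field_simps)
  moreover have "\<gamma> / q1 < real CARD('n) / q1"
    using assms by (simp add: divide_strict_right_mono)
  ultimately obtain a where a: "\<gamma> / q1 < a" "a < min (real CARD('n) - \<gamma>) (real CARD('n) / q1)"
    using dense[of "\<gamma> / q1" "min (real CARD('n) - \<gamma>) (real CARD('n) / q1)"] by auto
  have "\<gamma> / q1 > 0"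
    using assms by simp
  then have "a > 0"
    using a(1) by (rule less_trans)
  moreover have "a < real CARD('n) - \<gamma>" "\<gamma> < a * q1" "a * q1 < real CARD('n)"
    using a assms(3) by (simp_all add: field_simps)
  ultimately show thesis
    using assms
    by (intro that[of "\<lambda>x. norm x powr - a" "\<lambda>x. norm x powr - (a * q1)"])
       (auto intro!: power_solution[where a = a] norm_powr_radially_decreasing norm_powr_Linfty_loc)
qed

theorem theorem1p5:
  fixes \<gamma> q\<^sub>1 q\<^sub>2 :: real
  assumes "0 < \<gamma>" and "\<gamma> < real CARD('n::finite)"
    and "min q\<^sub>1 q\<^sub>2 > 0"
  shows "((0 < q\<^sub>1 * q\<^sub>2 \<and> q\<^sub>1 * q\<^sub>2 < 1) \<or>
          (0 < q\<^sub>1 \<and> q\<^sub>1 \<le> \<gamma> / (real CARD('n) - \<gamma>)) \<or>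
          q\<^sub>2 \<ge> (real CARD('n) - \<gamma>) / \<gamma> \<longrightarrow>
          \<not> (\<exists>u v :: real ^ 'n \<Rightarrow> real.
               pos_super_solution \<gamma> q\<^sub>1 q\<^sub>2 u v \<and> u \<in> Linfty_loc \<and> v \<in> Linfty_loc)) \<and>
         (q\<^sub>1 * q\<^sub>2 = 1 \<and>
          (q\<^sub>1 > \<gamma> / (real CARD('n) - \<gamma>) \<or>
           (0 < q\<^sub>2 \<and> q\<^sub>2 < (real CARD('n) - \<gamma>) / \<gamma>)) \<longrightarrow>
          (\<exists>u v :: real ^ 'n \<Rightarrow> real.
               pos_super_solution \<gamma> q\<^sub>1 q\<^sub>2 u v \<and>
               radially_decreasing u \<and> radially_decreasing v \<and>
               u \<in> Linfty_loc \<and> v \<in> Linfty_loc) \<and>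
          (\<exists>u v :: real ^ 'n \<Rightarrow> real.
               pos_lower_solution \<gamma> q\<^sub>1 q\<^sub>2 u v \<and>
               radially_decreasing u \<and> radially_decreasing v \<and>
               u \<in> Linfty_loc \<and> v \<in> Linfty_loc))"
proof -
  have q: "q\<^sub>1 > 0" "q\<^sub>2 > 0"
    using assms(3) by auto
  show ?thesis
  proof (intro conjI impI, goal_cases)
    case 1
    then show ?case
      using no_super_solution[OF assms(1,2) q] by blast
  next
    case 2
    then show ?case
      using ex_power_solution[OF assms(1,2) q] by metis
  next
    case 3
    then show ?case
      using ex_power_solution[OF assms(1,2) q] by metis
  qed
qed

end
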